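(* There exist absolute constants $c,C>0$ such that for every integer $n\ge1$ and all $p=(p_1,\dots,p_n),\,q=(q_1,\dots,q_n)\in[0,1]^n$, \[ c\,J(p,q)\;\le\; d_{\mathrm{TV}}\bigl(\mathrm{Ber}(p),\mathrm{Ber}(q)\bigr)\;\le\; C\,J(p,q), \] where \[ J(p,q)=\int_0^\infty w(t)\Bigl(1-\prod_{i=1}^n\bigl(1-\lambda_i+\lambda_i e^{-t a_i^2}\bigr)\Bigr)\,dt,\qquad w(t)=\frac{1}{2\sqrt\pi}\,t^{-3/2}e^{-1/(4t)}\quad(t>0), \] $\lambda_i=p_i(1-q_i)+(1-p_i)q_i$, and $a_i=|p_i-q_i|/\lambda_i$ if $\lambda_i>0$, $a_i=0$ if $\lambda_i=0$.
   Context: For probability measures $\mu,\nu$ on a finite set, $d_{\mathrm{TV}}(\mu,\nu)=\frac12\sum_x|\mu(x)-\nu(x)|$. For $s\in[0,1]$, $\mathrm{Ber}(s)$ is the Bernoulli law on $\{0,1\}$ giving mass $s$ to $1$ and $1-s$ to $0$. For a vector $p=(p_1,\dots,p_n)\in[0,1]^n$, $\mathrm{Ber}(p)=\bigotimes_{i=1}^n\mathrm{Ber}(p_i)$ is the product measure on $\{0,1\}^n$. The constants $c,C$ do not depend on $n$, $p$ or $q$. *)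

theory Defs
  imports "HOL-Probability.Probability"
begin

(* The sample space {0,1}^n, with 0/1 represented by False/True. A point is a function on nat
   that is False outside the index set {1..n}, matching the convention of Pi_pmf with default
   value False. *)
definition cube :: "nat \<Rightarrow> (nat \<Rightarrow> bool) set" where
  "cube n = PiE_dflt {1..n} False (\<lambda>_. UNIV)"

definition Ber :: "nat \<Rightarrow> (nat \<Rightarrow> real) \<Rightarrow> (nat \<Rightarrow> bool) pmf" where
  "Ber n p = Pi_pmf {1..n} False (\<lambda>i. bernoulli_pmf (p i))"

(* The sum is over an explicit finite set \<Omega>, to be chosen so that it carries both measures. *)
definition tv_dist :: "'a set \<Rightarrow> 'a pmf \<Rightarrow> 'a pmf \<Rightarrow> real" where
  "tv_dist \<Omega> \<mu> \<nu> = 1 / 2 * (\<Sum>x\<in>\<Omega>. \<bar>pmf \<mu> x - pmf \<nu> x\<bar>)"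

(* The one-sided 1/2-stable density, with Laplace transform exp (- sqrt s); used for t > 0 only. *)
definition w :: "real \<Rightarrow> real" where
  "w t = 1 / (2 * sqrt pi) * t powr (- 3 / 2) * exp (- 1 / (4 * t))"

definition lam :: "real \<Rightarrow> real \<Rightarrow> real" where
  "lam x y = x * (1 - y) + (1 - x) * y"

definition amp :: "real \<Rightarrow> real \<Rightarrow> real" where
  "amp x y = (if lam x y > 0 then \<bar>x - y\<bar> / lam x y else 0)"

definition J :: "nat \<Rightarrow> (nat \<Rightarrow> real) \<Rightarrow> (nat \<Rightarrow> real) \<Rightarrow> real" where
  "J n p q = (LINT t:{0<..}|lborel.
     w t * (1 - (\<Prod>i=1..n. (1 - lam (p i) (q i) + lam (p i) (q i) * exp (- t * (amp (p i) (q i))\<^sup>2)))))"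

end

theory Submission
  imports Defs
begin

text \<open>Let \<open>X \<sim> Ber(p)\<close> and \<open>Y \<sim> Ber(q)\<close> be independent. The total variation distance between the
  laws of \<open>(X, Y)\<close> and \<open>(Y, X)\<close> lies between that of \<open>Ber(p)\<close> and \<open>Ber(q)\<close> and twice
  that. Condition on the random set \<open>B = {i. X\<^sub>i \<noteq> Y\<^sub>i}\<close>, which contains each \<open>i\<close> independently with
  probability \<open>\<lambda>\<^sub>i\<close>: the two laws differ only in the orientations of the pairs
  \<open>(X\<^sub>i, Y\<^sub>i)\<close>, \<open>i \<in> B\<close>, which are independent signs with means \<open>\<plusminus> (p\<^sub>i - q\<^sub>i) / \<lambda>\<^sub>i\<close>. The
  distance between two such opposite sign biases is comparable to \<open>min(1, \<surd>S\<^sub>B)\<close> with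
  \<open>S\<^sub>B = \<Sum>\<^sub>i\<^sub>\<in>\<^sub>B a\<^sub>i\<^sup>2\<close>. On the other side, expanding the product writes \<open>J(p, q)\<close> as the mean over
  \<open>B\<close> of \<open>\<integral> w(t) (1 - exp(- t S\<^sub>B)) dt\<close>, which is comparable to the same quantity.\<close>

subsection \<open>Product weights on subsets\<close>

text \<open>The probability that a random subset of \<open>I\<close>, containing each
  \<open>i\<close> independently with probability \<open>r i\<close>, equals \<open>X\<close>. It
  serves both for points of the cube, identified with their supports, and for the random set
  \<open>B\<close> of disagreements.\<close>

definition wt :: "'a set \<Rightarrow> ('a \<Rightarrow> real) \<Rightarrow> 'a set \<Rightarrow> real" where
  "wt I r X = (\<Prod>i\<in>I. if i \<in> X then r i else 1 - r i)"

lemma sum_Pow_insert: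
  fixes f :: "'a set \<Rightarrow> 'b :: comm_monoid_add"
  assumes "finite I" "i \<notin> I"
  shows "(\<Sum>X\<in>Pow (insert i I). f X) = (\<Sum>X\<in>Pow I. f X + f (insert i X))"
proof -
  have inj: "inj_on (insert i) (Pow I)"
    using assms(2) by (auto simp: inj_on_def)
  have "(\<Sum>X\<in>Pow (insert i I). f X) = (\<Sum>X\<in>Pow I. f X) + (\<Sum>X\<in>insert i ` Pow I. f X)"
    unfolding Pow_insert using assms by (intro sum.union_disjoint) auto
  also have "(\<Sum>X\<in>insert i ` Pow I. f X) = (\<Sum>X\<in>Pow I. f (insert i X))"
    using sum.reindex[OF inj] by simp
  finally show ?thesis
    by (simp add: sum.distrib)
qed

lemma sum_Pow_prod_if:
  fixes a b :: "'a \<Rightarrow> 'b :: comm_semiring_1"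
  assumes "finite I"
  shows "(\<Sum>X\<in>Pow I. \<Prod>i\<in>I. if i \<in> X then a i else b i) = (\<Prod>i\<in>I. a i + b i)"
proof -
  have "(\<Prod>i\<in>I. if i \<in> X then a i else b i) = prod a X * prod b (I - X)" if "X \<in> Pow I" for X
    using that assms prod.If_cases[of I "\<lambda>i. i \<in> X" a b]
    by (simp add: Int_absorb1 Collect_mem_eq Diff_eq)
  then show ?thesis
    by (simp add: prod_add[OF assms])
qed

lemma wt_nonneg: "(\<And>i. i \<in> I \<Longrightarrow> r i \<in> {0..1}) \<Longrightarrow> wt I r X \<ge> 0"
  unfolding wt_def by (intro prod_nonneg) auto

lemma sum_wt: "finite I \<Longrightarrow> (\<Sum>X\<in>Pow I. wt I r X) = 1"
  unfolding wt_def by (simp add: sum_Pow_prod_if)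

lemma wt_insert:
  assumes "finite I" "i \<notin> I"
  shows "X \<in> Pow I \<Longrightarrow> wt (insert i I) r X = (1 - r i) * wt I r X"
    and "wt (insert i I) r (insert i X) = r i * wt I r X"
proof -
  show "wt (insert i I) r X = (1 - r i) * wt I r X" if "X \<in> Pow I"
    unfolding wt_def using assms that by auto
  have "(\<Prod>j\<in>I. if j \<in> insert i X then r j else 1 - r j) = (\<Prod>j\<in>I. if j \<in> X then r j else 1 - r j)"
    using assms by (intro prod.cong) auto
  then show "wt (insert i I) r (insert i X) = r i * wt I r X"
    unfolding wt_def using assms by simp
qed

subsection \<open>Symmetrization\<close>

text \<open>Points of the cube are \<open>False\<close> outside \<open>{1..n}\<close>, so passing to
  supports is a bijection onto \<open>Pow {1..n}\<close>. The range hypotheses make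
  \<open>bernoulli_pmf (p i)\<close> have mass exactly \<open>p i\<close> at
  \<open>True\<close>.\<close>

lemma tv_dist_Ber:
  assumes "\<And>i. i \<in> {1..n} \<Longrightarrow> p i \<in> {0..1}" "\<And>i. i \<in> {1..n} \<Longrightarrow> q i \<in> {0..1}"
  shows "tv_dist (cube n) (Ber n p) (Ber n q) =
           1 / 2 * (\<Sum>X\<in>Pow {1..n}. \<bar>wt {1..n} p X - wt {1..n} q X\<bar>)"
proof -
  have pmf_Ber: "pmf (Ber n r) x = wt {1..n} r {i. x i}"
    if "x \<in> cube n" "\<And>i. i \<in> {1..n} \<Longrightarrow> r i \<in> {0..1}" for x r
  proof -
    have "pmf (Ber n r) x = (\<Prod>i\<in>{1..n}. pmf (bernoulli_pmf (r i)) (x i))"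
      unfolding Ber_def using that by (subst pmf_Pi) (auto simp: cube_def PiE_dflt_def)
    also have "\<dots> = wt {1..n} r {i. x i}"
      unfolding wt_def using that(2) by (intro prod.cong) auto
    finally show ?thesis .
  qed
  have "(\<Sum>x\<in>cube n. \<bar>pmf (Ber n p) x - pmf (Ber n q) x\<bar>) =
        (\<Sum>X\<in>Pow {1..n}. \<bar>wt {1..n} p X - wt {1..n} q X\<bar>)"
  proof (rule sum.reindex_bij_witness[of _ "\<lambda>X i. i \<in> X" "\<lambda>x. {i. x i}"])
    fix x assume "x \<in> cube n"
    then show "\<bar>wt {1..n} p {i. x i} - wt {1..n} q {i. x i}\<bar> = \<bar>pmf (Ber n p) x - pmf (Ber n q) x\<bar>"
      using assms by (simp only: pmf_Ber)
  qed (auto simp: cube_def PiE_dflt_def)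
  then show ?thesis
    by (simp add: tv_dist_def)
qed

text \<open>Summing out \<open>y\<close> inside the absolute value recovers
  \<open>P x - Q x\<close>, which gives the first bound. For the second, the product of
  \<open>P\<close> and \<open>Q\<close> is compared with its swap through the product of
  \<open>Q\<close> with itself, changing one factor at a time.\<close>

lemma symmetrize_bounds:
  fixes P Q :: "'a \<Rightarrow> real"
  assumes nonneg: "\<And>x. x \<in> A \<Longrightarrow> P x \<ge> 0" "\<And>x. x \<in> A \<Longrightarrow> Q x \<ge> 0"
    and total: "sum P A = 1" "sum Q A = 1"
  shows "(\<Sum>x\<in>A. \<bar>P x - Q x\<bar>) \<le> (\<Sum>x\<in>A. \<Sum>y\<in>A. \<bar>P x * Q y - Q x * P y\<bar>)"
    and "(\<Sum>x\<in>A. \<Sum>y\<in>A. \<bar>P x * Q y - Q x * P y\<bar>) \<le> 2 * (\<Sum>x\<in>A. \<bar>P x - Q x\<bar>)"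
proof -
  show "(\<Sum>x\<in>A. \<bar>P x - Q x\<bar>) \<le> (\<Sum>x\<in>A. \<Sum>y\<in>A. \<bar>P x * Q y - Q x * P y\<bar>)"
  proof (rule sum_mono)
    fix x
    have "P x - Q x = (\<Sum>y\<in>A. P x * Q y - Q x * P y)"
      by (simp add: sum_subtractf flip: sum_distrib_left) (simp add: total)
    then show "\<bar>P x - Q x\<bar> \<le> (\<Sum>y\<in>A. \<bar>P x * Q y - Q x * P y\<bar>)"
      by (simp add: sum_abs)
  qed
  have "\<bar>P x * Q y - Q x * P y\<bar> \<le> \<bar>P x - Q x\<bar> * Q y + Q x * \<bar>P y - Q y\<bar>"
    if "x \<in> A" "y \<in> A" for x y
  proof -
    have "P x * Q y - Q x * P y = (P x - Q x) * Q y - Q x * (P y - Q y)"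
      by (simp add: algebra_simps)
    also have "\<bar>\<dots>\<bar> \<le> \<bar>(P x - Q x) * Q y\<bar> + \<bar>Q x * (P y - Q y)\<bar>"
      by (rule abs_triangle_ineq4)
    finally show ?thesis
      using nonneg that by (simp add: abs_mult)
  qed
  then have "(\<Sum>x\<in>A. \<Sum>y\<in>A. \<bar>P x * Q y - Q x * P y\<bar>) \<le>
      (\<Sum>x\<in>A. \<Sum>y\<in>A. \<bar>P x - Q x\<bar> * Q y + Q x * \<bar>P y - Q y\<bar>)"
    by (intro sum_mono)
  also have "\<dots> = 2 * (\<Sum>x\<in>A. \<bar>P x - Q x\<bar>)"
    by (simp add: sum.distrib total flip: sum_distrib_left sum_distrib_right)
  finally show "(\<Sum>x\<in>A. \<Sum>y\<in>A. \<bar>P x * Q y - Q x * P y\<bar>) \<le> 2 * (\<Sum>x\<in>A. \<bar>P x - Q x\<bar>)" .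
qed

text \<open>The weights \<open>\<alpha>\<close>, \<open>\<beta>\<close> absorb the factors of one coordinate in the induction step.\<close>
lemma sum_symmetrized_eq_mixture:
  assumes "finite I"
    and range: "\<And>i. i \<in> I \<Longrightarrow> p i \<in> {0..1}" "\<And>i. i \<in> I \<Longrightarrow> q i \<in> {0..1}"
    and l: "\<And>i. i \<in> I \<Longrightarrow> l i = lam (p i) (q i)"
    and h: "\<And>i. i \<in> I \<Longrightarrow> l i * h i = p i * (1 - q i)"
  shows "(\<Sum>X\<in>Pow I. \<Sum>Y\<in>Pow I. \<bar>\<alpha> * (wt I p X * wt I q Y) - \<beta> * (wt I q X * wt I p Y)\<bar>) =
    (\<Sum>B\<in>Pow I. wt I l B *
      (\<Sum>X\<in>Pow B. \<bar>\<alpha> * wt B h X - \<beta> * wt B (\<lambda>i. 1 - h i) X\<bar>))"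
  using assms
proof (induction I arbitrary: \<alpha> \<beta> rule: finite_induct)
  case empty
  then show ?case by (simp add: wt_def)
next
  case (insert i I)
  define G where "G \<alpha> \<beta> = (\<Sum>X\<in>Pow I. \<Sum>Y\<in>Pow I.
      \<bar>\<alpha> * (wt I p X * wt I q Y) - \<beta> * (wt I q X * wt I p Y)\<bar>)" for \<alpha> \<beta>
  define H where "H B \<alpha> \<beta> = (\<Sum>X\<in>Pow B. \<bar>\<alpha> * wt B h X - \<beta> * wt B (\<lambda>i. 1 - h i) X\<bar>)"
    for B \<alpha> \<beta>
  have IH: "G \<alpha> \<beta> = (\<Sum>B\<in>Pow I. wt I l B * H B \<alpha> \<beta>)" for \<alpha> \<beta>
    unfolding G_def H_def using insert by (intro insert.IH) auto
  have G_scale: "G (k * \<alpha>) (k * \<beta>) = k * G \<alpha> \<beta>" if "k \<ge> 0" for k \<alpha> \<beta>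
    unfolding G_def sum_distrib_left using that
    by (intro sum.cong refl) (simp add: mult.assoc abs_mult flip: right_diff_distrib)
  have H_scale: "H B (k * \<alpha>) (k * \<beta>) = k * H B \<alpha> \<beta>" if "k \<ge> 0" for B k \<alpha> \<beta>
    unfolding H_def sum_distrib_left using that
    by (intro sum.cong refl) (simp add: mult.assoc abs_mult flip: right_diff_distrib)
  have li: "l i = p i * (1 - q i) + (1 - p i) * q i" and hi: "l i * h i = p i * (1 - q i)"
    using insert.prems(3,4)[of i] by (auto simp: lam_def)
  have pq: "0 \<le> p i" "p i \<le> 1" "0 \<le> q i" "q i \<le> 1"
    using insert.prems(1,2)[of i] by auto
  have l0: "l i \<ge> 0"
    unfolding li using pq by simp
  \<comment> \<open>Four cases for the membership of \<open>i\<close> in \<open>X\<close> and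
    \<open>Y\<close>. In the two concordant ones \<alpha> and \<beta> get the same factor, and these
    factors add up to \<open>1 - l i\<close>. In the two discordant ones a common \<open>l i\<close>
    splits off, leaving \<open>h i\<close> on one side and \<open>1 - h i\<close> on the
    other.\<close>
  have "(\<Sum>X\<in>Pow (insert i I). \<Sum>Y\<in>Pow (insert i I).
      \<bar>\<alpha> * (wt (insert i I) p X * wt (insert i I) q Y) - \<beta> * (wt (insert i I) q X * wt (insert i I) p Y)\<bar>) =
      G ((1 - p i) * (1 - q i) * \<alpha>) ((1 - p i) * (1 - q i) * \<beta>) + G (p i * q i * \<alpha>) (p i * q i * \<beta>)
       + G (l i * (\<alpha> * h i)) (l i * (\<beta> * (1 - h i))) + G (l i * (\<alpha> * (1 - h i))) (l i * (\<beta> * h i))"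
  proof -
    \<comment> \<open>Here \<open>h i\<close> is the conditional probability of \<open>i\<close>
      lying in \<open>X\<close> only, given disagreement. The multiplied-out form of its defining
      equation also covers \<open>l i = 0\<close>.\<close>
    have e: "l i * (\<alpha> * h i) = p i * (1 - q i) * \<alpha>" "l i * (\<beta> * (1 - h i)) = (1 - p i) * q i * \<beta>" 
       "l i * (\<alpha> * (1 - h i)) = (1 - p i) * q i * \<alpha>"  "l i * (\<beta> * h i) = p i * (1 - q i) * \<beta>"
      using hi li by algebra+
    show ?thesis
      unfolding e G_def using insert.hyps
      by (simp add: sum_Pow_insert wt_insert sum.distrib algebra_simps)
  qed
  also have "\<dots> = (1 - l i) * G \<alpha> \<beta> + l i * (G (\<alpha> * h i) (\<beta> * (1 - h i)) + G (\<alpha> * (1 - h i)) (\<beta> * h i))"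
  proof -
    have "0 \<le> (1 - p i) * (1 - q i)" "0 \<le> p i * q i"
      using pq by simp_all
    note scale = this[THEN G_scale] G_scale[OF l0]
    show ?thesis
      unfolding scale by (simp add: li algebra_simps)
  qed
  also have "\<dots> = (\<Sum>B\<in>Pow I. (1 - l i) * wt I l B * H B \<alpha> \<beta> +
      l i * wt I l B * (H B (\<alpha> * h i) (\<beta> * (1 - h i)) + H B (\<alpha> * (1 - h i)) (\<beta> * h i)))"
    unfolding IH sum_distrib_left sum.distrib[symmetric]
    by (intro sum.cong refl) (simp add: algebra_simps)
  also have "\<dots> = (\<Sum>B\<in>Pow I. wt (insert i I) l B * H B \<alpha> \<beta> +
      wt (insert i I) l (insert i B) * H (insert i B) \<alpha> \<beta>)"
  proof (intro sum.cong refl)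
    fix B assume B: "B \<in> Pow I"
    then have fB: "finite B" "i \<notin> B"
      using insert.hyps finite_subset by auto
    have "H (insert i B) \<alpha> \<beta> = H B (\<alpha> * h i) (\<beta> * (1 - h i)) + H B (\<alpha> * (1 - h i)) (\<beta> * h i)"
      unfolding H_def using fB by (simp add: sum_Pow_insert wt_insert sum.distrib mult.assoc)
    then show "(1 - l i) * wt I l B * H B \<alpha> \<beta> +
      l i * wt I l B * (H B (\<alpha> * h i) (\<beta> * (1 - h i)) + H B (\<alpha> * (1 - h i)) (\<beta> * h i)) = 
      wt (insert i I) l B * H B \<alpha> \<beta> + wt (insert i I) l (insert i B) * H (insert i B) \<alpha> \<beta>"
      using B insert.hyps by (simp add: wt_insert)
  qed
  also have "\<dots> = (\<Sum>B\<in>Pow (insert i I). wt (insert i I) l B * H B \<alpha> \<beta>)"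
    using insert.hyps by (simp add: sum_Pow_insert)
  finally show ?case
    unfolding H_def .
qed

subsection \<open>Opposite sign biases\<close>

text \<open>For uniform \<open>X\<close> this is a Rademacher sum with coefficients
  \<open>d i\<close>. Up to a constant factor it is also the first-order term in \<open>d\<close> of
  the difference of the two sign laws compared below, hence the natural test statistic.\<close>

definition linstat :: "'a set \<Rightarrow> ('a \<Rightarrow> real) \<Rightarrow> 'a set \<Rightarrow> real" where
  "linstat B d X = (\<Sum>i\<in>B. if i \<in> X then d i else - d i)"

lemma linstat_insert:
  assumes "finite I" "i \<notin> I"
  shows "X \<in> Pow I \<Longrightarrow> linstat (insert i I) d X = linstat I d X - d i"
    and "linstat (insert i I) d (insert i X) = linstat I d X + d i"
proof -
  show "linstat (insert i I) d X = linstat I d X - d i" if "X \<in> Pow I"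
    unfolding linstat_def using assms that by auto
  have "(\<Sum>j\<in>I. if j \<in> insert i X then d j else - d j) = (\<Sum>j\<in>I. if j \<in> X then d j else - d j)"
    using assms by (intro sum.cong) auto
  then show "linstat (insert i I) d (insert i X) = linstat I d X + d i"
    unfolding linstat_def using assms by simp
qed

text \<open>Orthogonality of the signs: adding the squares of \<open>T - d i\<close> and
  \<open>T + d i\<close> cancels the cross term.\<close>

lemma sum_linstat_power2:
  assumes "finite B"
  shows "(\<Sum>X\<in>Pow B. (linstat B d X)\<^sup>2) = 2 ^ card B * (\<Sum>i\<in>B. (d i)\<^sup>2)"
  using assms
proof (induction B rule: finite_induct)
  case empty
  then show ?case by (simp add: linstat_def)
next
  case (insert i B)
  have "(\<Sum>X\<in>Pow (insert i B). (linstat (insert i B) d X)\<^sup>2) =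
      (\<Sum>X\<in>Pow B. 2 * (linstat B d X)\<^sup>2 + 2 * (d i)\<^sup>2)"
    using insert.hyps by (subst sum_Pow_insert) (auto simp: linstat_insert power2_eq_square algebra_simps intro!: sum.cong)
  also have "\<dots> = 2 * (2 ^ card B * (\<Sum>i\<in>B. (d i)\<^sup>2)) + 2 ^ card B * (2 * (d i)\<^sup>2)"
    using insert.hyps by (simp add: sum.distrib card_Pow insert.IH flip: sum_distrib_left)
  finally show ?case
    using insert.hyps by (simp add: algebra_simps)
qed

text \<open>The fourth-moment Khinchine inequality with constant 3; odd powers of the new sign
  cancel.\<close>

lemma sum_linstat_power4:
  assumes "finite B"
  shows "(\<Sum>X\<in>Pow B. (linstat B d X) ^ 4) \<le> 2 ^ card B * (3 * (\<Sum>i\<in>B. (d i)\<^sup>2)\<^sup>2)"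
  using assms
proof (induction B rule: finite_induct)
  case empty
  then show ?case by (simp add: linstat_def)
next
  case (insert i B)
  define S where "S = (\<Sum>i\<in>B. (d i)\<^sup>2)"
  define N :: real where "N = 2 ^ card B"
  have "(\<Sum>X\<in>Pow (insert i B). (linstat (insert i B) d X) ^ 4) =
      (\<Sum>X\<in>Pow B. 2 * (linstat B d X) ^ 4 + 12 * (d i)\<^sup>2 * (linstat B d X)\<^sup>2 + 2 * d i ^ 4)"
    using insert.hyps by (subst sum_Pow_insert)
      (auto simp: linstat_insert power2_eq_square power4_eq_xxxx algebra_simps intro!: sum.cong)
  also have "\<dots> = 2 * (\<Sum>X\<in>Pow B. (linstat B d X) ^ 4) + 12 * (d i)\<^sup>2 * (N * S) + N * (2 * d i ^ 4)"
    using insert.hyps sum_linstat_power2[of B d]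
    by (simp add: sum.distrib card_Pow N_def S_def flip: sum_distrib_left)
  \<comment> \<open>Enlarging the coefficient 2 of \<open>d i ^ 4\<close> to 6 completes the
    square.\<close>
  also have "\<dots> \<le> 2 * (N * (3 * S\<^sup>2)) + 12 * (d i)\<^sup>2 * (N * S) + N * (6 * d i ^ 4)"
    using insert.IH unfolding S_def N_def by (intro add_mono mult_left_mono) auto
  also have "\<dots> = 2 * N * (3 * ((d i)\<^sup>2 + S)\<^sup>2)"
    by (simp add: power2_eq_square power4_eq_xxxx algebra_simps)
  finally show ?case
    using insert.hyps by (simp add: S_def N_def)
qed

text \<open>Linearity of expectation: the sign at \<open>i\<close> has mean
  \<open>e i\<close>.\<close>

lemma sum_wt_linstat:
  assumes "finite B" "\<And>i. i \<in> B \<Longrightarrow> r i = (1 + e i) / 2"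
  shows "(\<Sum>X\<in>Pow B. wt B r X * linstat B d X) = (\<Sum>i\<in>B. e i * d i)"
  using assms
proof (induction B rule: finite_induct)
  case empty
  then show ?case by (simp add: linstat_def)
next
  case (insert i B)
  have "(\<Sum>X\<in>Pow (insert i B). wt (insert i B) r X * linstat (insert i B) d X) =
      (\<Sum>X\<in>Pow B. wt B r X * linstat B d X + wt B r X * (e i * d i))"
    using insert.hyps by (subst sum_Pow_insert)
      (auto simp: linstat_insert wt_insert insert.prems field_simps intro!: sum.cong)
  also have "\<dots> = (\<Sum>i\<in>B. e i * d i) + e i * d i"
    using insert by (simp add: sum.distrib sum_wt flip: sum_distrib_right)
  finally show ?case
    using insert.hyps by simp
qed

section \<open>Distance between a law of independent biased signs and its reflection\<close>

context
  fixes B :: "'a set" and h d :: "'a \<Rightarrow> real" and S :: real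
  assumes finB: "finite B"
    and h: "\<And>i. i \<in> B \<Longrightarrow> h i = (1 + d i) / 2"
    and d: "\<And>i. i \<in> B \<Longrightarrow> \<bar>d i\<bar> \<le> 1"
    and S: "S = (\<Sum>i\<in>B. (d i)\<^sup>2)"
begin

private abbreviation (input) "P \<equiv> wt B h"
private abbreviation (input) "Q \<equiv> wt B (\<lambda>i. 1 - h i)"
private abbreviation (input) "L \<equiv> \<Sum>X\<in>Pow B. \<bar>P X - Q X\<bar>"

lemma tilt_sq_le_1: "i \<in> B \<Longrightarrow> (d i)\<^sup>2 \<le> 1"
  using d[of i] by (simp add: abs_square_le_1)

lemma energy_nonneg: "0 \<le> S"
  by (simp add: S sum_nonneg)

lemma tilt_nonneg: "P X \<ge> 0" and tilt_neg_nonneg: "Q X \<ge> 0"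
  using h d by (intro wt_nonneg; fastforce simp: abs_le_iff)+

lemma tilt_l1_le_2: "L \<le> 2"
proof -
  have "L \<le> (\<Sum>X\<in>Pow B. P X + Q X)"
    using tilt_nonneg tilt_neg_nonneg by (intro sum_mono) (auto simp: abs_le_iff)
  then show ?thesis
    by (simp add: sum.distrib sum_wt finB)
qed

text \<open>At each coordinate one law contributes \<open>h i\<close> and the other
  \<open>1 - h i\<close>, so the product does not depend on \<open>X\<close>.\<close>

lemma tilt_prod_eq: "P X * Q X = (\<Prod>i\<in>B. h i * (1 - h i))"
  unfolding wt_def prod.distrib[symmetric] by (intro prod.cong) auto

text \<open>\<open>\<bar>P X - Q X\<bar>\<close> is \<open>P X + Q X\<close> minus twice the
  minimum, and the minimum is at most the geometric mean. The latter is constant in \<open>X\<close>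
  and at most \<open>exp (- S / 2) / 2 ^ card B\<close>. The bound is effective for large
  \<open>S\<close>.\<close>

lemma tilt_l1_ge_Hellinger: "2 - 2 * exp (- S / 2) \<le> L"
proof -
  have "(\<Prod>i\<in>B. h i * (1 - h i)) = (\<Prod>i\<in>B. (1 - (d i)\<^sup>2) / 4)"
    by (intro prod.cong) (auto simp: h field_simps power2_eq_square)
  also have "\<dots> \<le> (\<Prod>i\<in>B. exp (- (d i)\<^sup>2) / 4)"
  proof (intro prod_mono conjI divide_right_mono)
    show "1 - (d i)\<^sup>2 \<le> exp (- (d i)\<^sup>2)" for i
      using exp_ge_add_one_self[of "- (d i)\<^sup>2"] by simp
  qed (use tilt_sq_le_1 in auto)
  also have "\<dots> = exp (- S) / 4 ^ card B"
    by (simp add: prod_dividef S exp_sum[OF finB] flip: sum_negf)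
  also have "\<dots> = (exp (- S / 2) / 2 ^ card B)\<^sup>2"
    by (simp add: power_divide flip: exp_double power_mult_distrib power_mult) (simp add: power_mult mult.commute[of _ 2])
  finally have PQ: "P X * Q X \<le> (exp (- S / 2) / 2 ^ card B)\<^sup>2" for X
    by (simp add: tilt_prod_eq)
  have "P X + Q X - 2 * (exp (- S / 2) / 2 ^ card B) \<le> \<bar>P X - Q X\<bar>" for X
  proof -
    define m where "m = min (P X) (Q X)"
    have "m * m \<le> P X * Q X"
      using tilt_nonneg tilt_neg_nonneg by (intro mult_mono) (auto simp: m_def)
    then have "m\<^sup>2 \<le> (exp (- S / 2) / 2 ^ card B)\<^sup>2"
      using PQ[of X] by (simp add: power2_eq_square)
    then have "m \<le> exp (- S / 2) / 2 ^ card B"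
      by (rule power2_le_imp_le) simp
    then show ?thesis
      unfolding m_def by linarith
  qed
  then have "(\<Sum>X\<in>Pow B. P X + Q X - 2 * (exp (- S / 2) / 2 ^ card B)) \<le> L"
    by (intro sum_mono)
  then show ?thesis
    by (simp add: sum.distrib sum_subtractf sum_wt finB card_Pow)
qed

text \<open>After expanding the square, each of the three sums over \<open>X\<close> factorizes over
  the coordinates.\<close>

lemma tilt_l2:
  "(\<Sum>X\<in>Pow B. (P X - Q X)\<^sup>2) = 2 * ((\<Prod>i\<in>B. 1 + (d i)\<^sup>2) - (\<Prod>i\<in>B. 1 - (d i)\<^sup>2)) / 2 ^ card B"
proof -
  have h2: "h i * h i + (1 - h i) * (1 - h i) = (1 + (d i)\<^sup>2) / 2" 
    "h i * (1 - h i) = (1 - (d i)\<^sup>2) / 4" if "i \<in> B" for i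
    by (auto simp: h[OF that] field_simps power2_eq_square)
  have "(\<Sum>X\<in>Pow B. P X * P X) = (\<Prod>i\<in>B. h i * h i + (1 - h i) * (1 - h i))"
    unfolding sum_Pow_prod_if[OF finB, symmetric] wt_def prod.distrib[symmetric]
    by (intro sum.cong prod.cong) auto
  moreover have "(\<Sum>X\<in>Pow B. Q X * Q X) = (\<Prod>i\<in>B. (1 - h i) * (1 - h i) + h i * h i)"
    unfolding sum_Pow_prod_if[OF finB, symmetric] wt_def prod.distrib[symmetric]
    by (intro sum.cong prod.cong) auto
  ultimately have PP: "(\<Sum>X\<in>Pow B. P X * P X) = (\<Prod>i\<in>B. 1 + (d i)\<^sup>2) / 2 ^ card B"
    and QQ: "(\<Sum>X\<in>Pow B. Q X * Q X) = (\<Prod>i\<in>B. 1 + (d i)\<^sup>2) / 2 ^ card B"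
    by (simp_all add: h2 prod_dividef add.commute cong: prod.cong)
  have "(\<Sum>X\<in>Pow B. P X * Q X) = 2 ^ card B * (\<Prod>i\<in>B. (1 - (d i)\<^sup>2) / 4)"
    by (simp add: tilt_prod_eq card_Pow finB h2 cong: prod.cong)
  also have "\<dots> = (\<Prod>i\<in>B. 1 - (d i)\<^sup>2) / 2 ^ card B"
    by (simp add: prod_dividef field_simps flip: power_mult_distrib)
  finally have PQ: "(\<Sum>X\<in>Pow B. P X * Q X) = (\<Prod>i\<in>B. 1 - (d i)\<^sup>2) / 2 ^ card B" .
  have "(\<Sum>X\<in>Pow B. (P X - Q X)\<^sup>2) =
      (\<Sum>X\<in>Pow B. P X * P X) + (\<Sum>X\<in>Pow B. Q X * Q X) - 2 * (\<Sum>X\<in>Pow B. P X * Q X)"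
    unfolding sum_distrib_left sum.distrib[symmetric] sum_subtractf[symmetric]
    by (intro sum.cong) (auto simp: power2_eq_square algebra_simps)
  then show ?thesis
    by (simp add: PP QQ PQ field_simps)
qed

text \<open>For \<open>S \<le> 1\<close> the two products in \<open>tilt_l2\<close> are at most
  \<open>1 + 2 * S\<close> and at least \<open>1 - S\<close>, so they differ by at most
  \<open>3 * S\<close>.\<close>

lemma tilt_l2_le:
  assumes "S \<le> 1"
  shows "(\<Sum>X\<in>Pow B. (P X - Q X)\<^sup>2) \<le> 6 * S / 2 ^ card B"
proof -
  have "(\<Prod>i\<in>B. 1 + (d i)\<^sup>2) \<le> (\<Prod>i\<in>B. exp ((d i)\<^sup>2))"
    by (intro prod_mono) auto
  also have "\<dots> = exp S"
    by (simp add: S exp_sum[OF finB])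
  also have "\<dots> \<le> 1 + S + S\<^sup>2"
    using energy_nonneg assms by (rule exp_bound)
  also have "\<dots> \<le> 1 + 2 * S"
    using energy_nonneg assms by (simp add: power2_eq_square mult_left_le)
  moreover have "1 - S \<le> (\<Prod>i\<in>B. 1 - (d i)\<^sup>2)"
    unfolding S using tilt_sq_le_1 by (intro Weierstrass_prod_ineq) auto
  ultimately show ?thesis
    unfolding tilt_l2 by (intro divide_right_mono) auto
qed

text \<open>Cauchy-Schwarz against the constant 1 on \<open>2 ^ card B\<close> sets, and 6 is at
  most 9.\<close>

lemma tilt_l1_upper:
  assumes "S \<le> 1"
  shows "L \<le> 3 * sqrt S"
proof -
  have "L\<^sup>2 = (\<Sum>X\<in>Pow B. \<bar>P X - Q X\<bar> * 1)\<^sup>2"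
    by simp
  also have "\<dots> \<le> (\<Sum>X\<in>Pow B. \<bar>P X - Q X\<bar>\<^sup>2) * (\<Sum>X\<in>Pow B. 1\<^sup>2)"
    by (rule Cauchy_Schwarz_ineq_sum)
  also have "\<dots> \<le> 6 * S / 2 ^ card B * 2 ^ card B"
    using tilt_l2_le[OF assms] finB by (simp add: card_Pow pos_le_divide_eq)
  also have "\<dots> \<le> (3 * sqrt S)\<^sup>2"
    using energy_nonneg by (simp add: power_mult_distrib)
  finally show ?thesis
    by (rule power2_le_imp_le) (simp add: energy_nonneg)
qed

text \<open>Testing \<open>P - Q\<close> against the linear statistic \<open>T\<close> gives \<open>2 S\<close>. The test is unbounded,
  but \<open>\<bar>T\<bar> \<le> K + T\<^sup>2 / (4 K)\<close> reduces it to a bounded one up to an error controlled by the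
  second moment of \<open>P - Q\<close> and the fourth moment of \<open>T\<close>; \<open>K = sqrt S\<close> balances the two.\<close>
lemma tilt_l1_lower:
  assumes "S \<le> 1"
  shows "sqrt S / 2 \<le> L"
proof (cases "S = 0")
  case True
  then show ?thesis by (simp add: sum_nonneg)
next
  case False
  define T where "T = linstat B d"
  define K where "K = sqrt S"
  have K: "K > 0" "K\<^sup>2 = S"
    using False energy_nonneg by (auto simp: K_def)
  have "(\<Sum>X\<in>Pow B. \<bar>P X - Q X\<bar> * (T X)\<^sup>2)\<^sup>2 \<le> (\<Sum>X\<in>Pow B. \<bar>P X - Q X\<bar>\<^sup>2) * (\<Sum>X\<in>Pow B. ((T X)\<^sup>2)\<^sup>2)"
    by (rule Cauchy_Schwarz_ineq_sum)
  also have "\<dots> = (\<Sum>X\<in>Pow B. (P X - Q X)\<^sup>2) * (\<Sum>X\<in>Pow B. T X ^ 4)"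
    by simp
  also have "\<dots> \<le> (6 * S / 2 ^ card B) * (2 ^ card B * (3 * S\<^sup>2))"
    unfolding T_def using tilt_l2_le[OF assms] sum_linstat_power4[OF finB, of d] energy_nonneg
    by (intro mult_mono) (auto simp flip: S intro!: sum_nonneg)
  also have "\<dots> = 18 * S ^ 3"
    by (simp add: power2_eq_square power3_eq_cube)
  \<comment> \<open>Rounding 18 up to 25 makes the bound the square of
    \<open>5 * K * S\<close>.\<close>
  also have "\<dots> \<le> 25 * S ^ 3"
    using energy_nonneg by simp
  also have "\<dots> = (5 * K * S)\<^sup>2"
    by (simp add: power_mult_distrib K(2) power3_eq_cube power2_eq_square[of S])
  finally have M: "(\<Sum>X\<in>Pow B. \<bar>P X - Q X\<bar> * (T X)\<^sup>2) \<le> 5 * K * S"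
    by (rule power2_le_imp_le) (use energy_nonneg K in auto)
  have "(\<Sum>X\<in>Pow B. P X * T X) = S"
    unfolding T_def by (subst sum_wt_linstat[where e = d]) (auto simp: finB h S power2_eq_square)
  moreover have "(\<Sum>X\<in>Pow B. Q X * T X) = - S"
    unfolding T_def by (subst sum_wt_linstat[where e = "\<lambda>i. - d i"])
      (auto simp: finB h S power2_eq_square sum_negf field_simps)
  ultimately have "2 * S = (\<Sum>X\<in>Pow B. (P X - Q X) * T X)"
    by (simp add: left_diff_distrib sum_subtractf)
  also have "\<dots> \<le> (\<Sum>X\<in>Pow B. K * \<bar>P X - Q X\<bar> + (\<bar>P X - Q X\<bar> * (T X)\<^sup>2) / (4 * K))"
  proof (rule sum_mono)
    fix X
    have "0 \<le> (\<bar>T X\<bar> - 2 * K)\<^sup>2"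
      by simp
    then have "\<bar>T X\<bar> \<le> K + (T X)\<^sup>2 / (4 * K)"
      using K(1) by (simp add: power2_diff field_simps power2_eq_square)
    then have "\<bar>P X - Q X\<bar> * \<bar>T X\<bar> \<le> \<bar>P X - Q X\<bar> * (K + (T X)\<^sup>2 / (4 * K))"
      by (rule mult_left_mono) simp
    moreover have "(P X - Q X) * T X \<le> \<bar>P X - Q X\<bar> * \<bar>T X\<bar>"
      by (simp flip: abs_mult)
    ultimately show "(P X - Q X) * T X \<le> K * \<bar>P X - Q X\<bar> + (\<bar>P X - Q X\<bar> * (T X)\<^sup>2) / (4 * K)"
      by (simp add: algebra_simps)
  qed
  also have "\<dots> = K * L + (\<Sum>X\<in>Pow B. \<bar>P X - Q X\<bar> * (T X)\<^sup>2) / (4 * K)"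
    by (simp add: sum.distrib sum_distrib_left sum_divide_distrib)
  also have "\<dots> \<le> K * L + (5 * K * S) / (4 * K)"
    using M K by (intro add_left_mono divide_right_mono) auto
  also have "\<dots> = K * L + 5 / 4 * S"
    using K by simp
  \<comment> \<open>From \<open>2 * S \<le> K * L + 5 / 4 * S\<close>, with \<open>S\<close> written
    as the square of \<open>K\<close>.\<close>
  finally have "K * (3 / 4 * K) \<le> K * L"
    by (simp flip: K(2) add: power2_eq_square)
  then have "3 / 4 * K \<le> L"
    using K(1) by (simp only: mult_le_cancel_left_pos)
  then show ?thesis
    using K(1) unfolding K_def by linarith
qed

lemma tilt_l1_bounds: "min 1 (sqrt S) / 2 \<le> L" "L \<le> 3 * min 1 (sqrt S)"
proof -
  have "min 1 (sqrt S) / 2 \<le> L \<and> L \<le> 3 * min 1 (sqrt S)"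
  proof (cases "S \<le> 1")
    case True
    then show ?thesis
      using tilt_l1_lower tilt_l1_upper by simp
  next
    case False
    \<comment> \<open>For \<open>S > 1\<close> the affinity is below 2/3, so the Hellinger bound
      gives \<open>L \<ge> 2 / 3\<close>.\<close>
    have "exp (- S / 2) \<le> inverse (1 + S / 2)"
      using False exp_ge_add_one_self[of "S / 2"]
      by (auto simp: exp_minus intro!: le_imp_inverse_le simp flip: minus_divide_left)
    also have "\<dots> \<le> 2 / 3"
      using False by (simp add: field_simps)
    finally show ?thesis
      using tilt_l1_ge_Hellinger tilt_l1_le_2 False by simp
  qed
  then show "min 1 (sqrt S) / 2 \<le> L" "L \<le> 3 * min 1 (sqrt S)"
    by auto
qed

end

subsection \<open>The integral transform of the stable density\<close>

lemma set_integral_FTC_atLeast: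
  fixes f F :: "real \<Rightarrow> real"
  assumes f: "f \<in> borel_measurable borel"
    and F: "\<And>x. a \<le> x \<Longrightarrow> (F has_real_derivative f x) (at x)"
    and nonneg: "\<And>x. a \<le> x \<Longrightarrow> 0 \<le> f x"
    and lim: "(F \<longlongrightarrow> T) at_top"
  shows "set_integrable lborel {a..} f" "(LINT x:{a..}|lborel. f x) = T - F a"
proof -
  \<comment> \<open>Monotonicity of \<open>F\<close> makes \<open>T - F a\<close> nonnegative, so
    its value survives the passage through \<open>ennreal\<close>.\<close>
  have "F a \<le> T"
  proof (rule tendsto_lowerbound[OF lim])
    show "\<forall>\<^sub>F x in at_top. F a \<le> F x"
      using eventually_ge_at_top[of a]
    proof eventually_elim
      case (elim x)
      then show ?case
        using F nonneg by (intro DERIV_nonneg_imp_nondecreasing[of a x F]) auto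
    qed
  qed simp
  moreover have "(\<integral>\<^sup>+x. ennreal (indicator {a..} x *\<^sub>R f x) \<partial>lborel) = T - F a"
  proof -
    have "(\<integral>\<^sup>+x. ennreal (indicator {a..} x *\<^sub>R f x) \<partial>lborel) =
        (\<integral>\<^sup>+x. ennreal (f x) * indicator {a..} x \<partial>lborel)"
      by (intro nn_integral_cong) (auto simp: indicator_def)
    also have "\<dots> = T - F a"
      using F nonneg by (intro nn_integral_FTC_atLeast[OF f _ _ lim]) auto
    finally show ?thesis .
  qed
  ultimately have "has_bochner_integral lborel (\<lambda>x. indicator {a..} x *\<^sub>R f x) (T - F a)"
    using f nonneg by (intro has_bochner_integral_nn_integral) (auto simp: indicator_def)
  then show "set_integrable lborel {a..} f" "(LINT x:{a..}|lborel. f x) = T - F a"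
    unfolding set_integrable_def set_lebesgue_integral_def
    by (simp_all add: has_bochner_integral_iff)
qed

section \<open>Pointwise bounds on the stable density\<close>

lemma w_measurable [measurable]: "w \<in> borel_measurable borel"
  unfolding w_def by measurable

lemma w_nonneg: "w t \<ge> 0"
  by (simp add: w_def)

lemma w_le:
  assumes "t > 0"
  shows "w t \<le> 15 * (1 + t) powr (- 3 / 2)"
proof -
  \<comment> \<open>The exponential factor of \<open>w\<close> must absorb the singularity at 0. The
    constant 6 is chosen so that the power 3/2 turns \<open>exp (1 / (6 * t))\<close> into
    \<open>exp (1 / (4 * t))\<close>.\<close>
  have "1 + t \<le> 6 * t * (1 + 1 / (6 * t))"
    using assms by (simp add: field_simps)
  also have "\<dots> \<le> 6 * t * exp (1 / (6 * t))"
    using assms by (intro mult_left_mono exp_ge_add_one_self) auto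
  finally have "(1 + t) powr (3 / 2) \<le> (6 * t * exp (1 / (6 * t))) powr (3 / 2)"
    using assms by (intro powr_mono2) auto
  also have "\<dots> = 6 powr (3 / 2) * t powr (3 / 2) * exp (1 / (4 * t))"
    using assms by (simp add: powr_mult exp_powr_real)
  also have "(6 :: real) powr (3 / 2) = 6 * sqrt 6"
    using powr_add[of 6 1 "1 / 2 :: real"] by (simp add: powr_half_sqrt)
  also have "6 * sqrt 6 * t powr (3 / 2) * exp (1 / (4 * t)) \<le> 15 * t powr (3 / 2) * exp (1 / (4 * t))"
  proof -
    have "sqrt 6 \<le> 5 / 2"
      by (rule real_le_lsqrt) (auto simp: power2_eq_square)
    then show ?thesis
      by (intro mult_right_mono) auto
  qed
  finally have "t powr (- 3 / 2) * exp (- 1 / (4 * t)) \<le> 15 * (1 + t) powr (- 3 / 2)"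
    using assms by (simp add: powr_minus exp_minus field_simps flip: minus_divide_left)
  moreover have "1 / (2 * sqrt pi) \<le> 1"
  proof -
    have "1 \<le> sqrt pi"
      using pi_gt3 by simp
    then have "1 \<le> 2 * sqrt pi"
      by linarith
    then show ?thesis
      by (subst divide_le_eq_1_pos) simp_all
  qed
  ultimately have "1 / (2 * sqrt pi) * (t powr (- 3 / 2) * exp (- 1 / (4 * t))) \<le> 1 * (15 * (1 + t) powr (- 3 / 2))"
    by - (rule mult_mono, assumption+, auto)
  then show ?thesis
    by (simp add: w_def)
qed

lemma w_ge:
  assumes "t \<ge> 1"
  shows "w t \<ge> t powr (- 3 / 2) / 8"
proof -
  have "sqrt pi \<le> 2"
    using pi_less_4 by (intro real_le_lsqrt) auto
  then have "1 / (2 * sqrt pi) \<ge> 1 / 4"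
    by (simp add: field_simps)
  moreover have "exp (- 1 / (4 * t)) \<ge> 1 / 2"
  proof -
    have "- 1 / (4 * t) \<ge> - 1 / 2"
      using assms by (simp add: field_simps)
    then show ?thesis
      using exp_ge_add_one_self[of "- 1 / (4 * t)"] by linarith
  qed
  ultimately have "1 / 4 * t powr (- 3 / 2) * (1 / 2) \<le> 1 / (2 * sqrt pi) * t powr (- 3 / 2) * exp (- 1 / (4 * t))"
    by (intro mult_mono) auto
  then show ?thesis
    by (simp add: w_def)
qed

text \<open>The shift allows two uses: \<open>b = 1\<close>, \<open>a = 0\<close> for upper bounds
  by \<open>w_le\<close>, and \<open>b = 0\<close> with a positive \<open>a\<close> for the lower
  bound by \<open>w_ge\<close>.\<close>

lemma integral_powr_tail:
  fixes a b :: real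
  assumes "a + b > 0"
  shows "set_integrable lborel {a..} (\<lambda>t. (b + t) powr (- 3 / 2))"
    and "(LINT t:{a..}|lborel. (b + t) powr (- 3 / 2)) = 2 * (b + a) powr (- 1 / 2)"
proof -
  have d: "((\<lambda>t. - 2 * (b + t) powr (- 1 / 2)) has_real_derivative (b + t) powr (- 3 / 2)) (at t)"
    if "a \<le> t" for t
    using that assms by (auto intro!: derivative_eq_intros simp: powr_diff field_simps)
  have l: "((\<lambda>t. - 2 * (b + t) powr (- 1 / 2)) \<longlongrightarrow> 0) at_top"
    by real_asymp
  show "set_integrable lborel {a..} (\<lambda>t. (b + t) powr (- 3 / 2))"
    using d l by (intro set_integral_FTC_atLeast(1)) auto
  have "(LINT t:{a..}|lborel. (b + t) powr (- 3 / 2)) = 0 - (- 2 * (b + a) powr (- 1 / 2))"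
    using d l by (intro set_integral_FTC_atLeast(2)) auto
  then show "(LINT t:{a..}|lborel. (b + t) powr (- 3 / 2)) = 2 * (b + a) powr (- 1 / 2)"
    by simp
qed

text \<open>The integrand has antiderivative
  \<open>2 * sqrt s * arctan (sqrt s * sqrt (1 + t))\<close>. It majorizes the transform integrand
  up to a constant: the rational factor imitates the saturation of \<open>1 - exp (- t * s)\<close>
  at \<open>t\<close> of order \<open>1 / s\<close>.\<close>

lemma integral_arctan_tail:
  assumes "s > 0"
  shows "set_integrable lborel {0..} (\<lambda>t. s / (sqrt (1 + t) * (1 + s * (1 + t))))"
    and "(LINT t:{0..}|lborel. s / (sqrt (1 + t) * (1 + s * (1 + t)))) \<le> 4 * sqrt s"
proof -
  define F where "F = (\<lambda>t. 2 * sqrt s * arctan (sqrt s * sqrt (1 + t)))"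
  have d: "(F has_real_derivative s / (sqrt (1 + t) * (1 + s * (1 + t)))) (at t)" if "0 \<le> t" for t
  proof -
    have "(F has_real_derivative 2 * sqrt s * (inverse (1 + (sqrt s * sqrt (1 + t))\<^sup>2) *
       (sqrt s * (inverse (sqrt (1 + t)) / 2)))) (at t)"
      unfolding F_def using that by (auto intro!: derivative_eq_intros)
    also have "2 * sqrt s * (inverse (1 + (sqrt s * sqrt (1 + t))\<^sup>2) * (sqrt s * (inverse (sqrt (1 + t)) / 2))) =
      (sqrt s * sqrt s) * inverse (1 + (sqrt s * sqrt (1 + t))\<^sup>2) * inverse (sqrt (1 + t))"
      by simp
    also have "\<dots> = s / (sqrt (1 + t) * (1 + s * (1 + t)))"
      using that assms by (simp add: power_mult_distrib divide_inverse mult_ac)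
    finally show ?thesis .
  qed
  have l: "(F \<longlongrightarrow> 2 * sqrt s * (pi / 2)) at_top"
    unfolding F_def
  proof (intro tendsto_intros filterlim_compose[OF tendsto_arctan_at_top])
    show "filterlim (\<lambda>t. sqrt s * sqrt (1 + t)) at_top at_top"
      using assms by real_asymp
  qed
  show "set_integrable lborel {0..} (\<lambda>t. s / (sqrt (1 + t) * (1 + s * (1 + t))))"
    using d l assms by (intro set_integral_FTC_atLeast(1)) auto
  have "(LINT t:{0..}|lborel. s / (sqrt (1 + t) * (1 + s * (1 + t)))) = 2 * sqrt s * (pi / 2) - F 0"
    using d l assms by (intro set_integral_FTC_atLeast(2)) auto
  also have "\<dots> \<le> 2 * sqrt s * (pi / 2)"
    using assms by (simp add: F_def)
  also have "\<dots> \<le> 2 * sqrt s * 2"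
    using assms pi_less_4 by (intro mult_left_mono) auto
  finally show "(LINT t:{0..}|lborel. s / (sqrt (1 + t) * (1 + s * (1 + t)))) \<le> 4 * sqrt s"
    by simp
qed

text \<open>Since \<open>w\<close> has Laplace transform \<open>exp (- sqrt s)\<close>, the exact
  value for \<open>s \<ge> 0\<close> is \<open>1 - exp (- sqrt s)\<close>. Only its comparability
  with \<open>min 1 (sqrt s)\<close> is established.\<close>

definition w_transform :: "real \<Rightarrow> real" where
  "w_transform s = (LINT t:{0<..}|lborel. w t * (1 - exp (- t * s)))"

section \<open>Two-sided bounds for the transform\<close>

lemma w_transform_bound:
  assumes "s \<ge> 0" "set_integrable lborel {0..} g"
    and g: "\<And>t. t > 0 \<Longrightarrow> w t * (1 - exp (- t * s)) \<le> g t"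
  shows "set_integrable lborel {0<..} (\<lambda>t. w t * (1 - exp (- t * s)))"
    and "w_transform s \<le> (LINT t:{0..}|lborel. g t)"
proof -
  have nonneg: "0 \<le> w t * (1 - exp (- t * s))" if "t > 0" for t
    using that assms(1) w_nonneg by simp
  have ig: "set_integrable lborel {0<..} g"
    by (rule set_integrable_subset[OF assms(2)]) auto
  show i: "set_integrable lborel {0<..} (\<lambda>t. w t * (1 - exp (- t * s)))"
  proof (rule set_integrable_bound[OF ig])
    show "AE t in lborel. t \<in> {0<..} \<longrightarrow> norm (w t * (1 - exp (- t * s))) \<le> norm (g t)"
      using nonneg g by (intro AE_I2) (fastforce simp: abs_le_iff)
  qed (simp add: set_borel_measurable_def)
  have "w_transform s \<le> (LINT t:{0<..}|lborel. g t)"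
    unfolding w_transform_def using i ig g by (intro set_integral_mono) auto
  also have "\<dots> = (LINT t:{0..}|lborel. g t)"
    unfolding set_lebesgue_integral_def
  proof (rule integral_cong_AE)
    show "AE t in lborel. indicator {0<..} t *\<^sub>R g t = indicator {0..} t *\<^sub>R g t"
      using AE_lborel_singleton[of "0 :: real"] by eventually_elim (auto simp: indicator_def)
  qed (use ig assms(2) in \<open>auto simp: set_integrable_def\<close>)
  finally show "w_transform s \<le> (LINT t:{0..}|lborel. g t)" .
qed

lemma w_transform_integrand_le:
  assumes "s \<ge> 0" "t > 0"
  shows "w t * (1 - exp (- t * s)) \<le> 15 * (1 + t) powr (- 3 / 2)"
proof -
  have "w t * (1 - exp (- t * s)) \<le> w t * 1"
    using w_nonneg by (intro mult_left_mono) auto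
  then show ?thesis
    using w_le[OF assms(2)] by simp
qed

lemma w_transform_integrable:
  assumes "s \<ge> 0"
  shows "set_integrable lborel {0<..} (\<lambda>t. w t * (1 - exp (- t * s)))"
  by (rule w_transform_bound(1)[OF assms _ w_transform_integrand_le[OF assms]])
    (use integral_powr_tail(1)[of 0 1] in auto)

text \<open>Both sides are compared with \<open>min 1 x\<close>; the rational majorant leads to an
  explicit integral.\<close>

lemma one_minus_exp_neg_le:
  fixes x :: real
  assumes "x > 0"
  shows "1 - exp (- x) \<le> 2 * x / (1 + x)"
proof -
  have "min 1 x * (1 + x) \<le> 2 * x"
    using assms by (auto simp: min_def algebra_simps mult_left_le)
  then have "min 1 x \<le> 2 * x / (1 + x)"
    using assms by (simp add: pos_le_divide_eq)
  moreover have "1 - exp (- x) \<le> min 1 x"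
    using exp_ge_add_one_self[of "- x"] by simp
  ultimately show ?thesis
    by linarith
qed

lemma w_transform_upper:
  assumes "s \<ge> 0"
  shows "w_transform s \<le> 240 * min 1 (sqrt s)"
proof (cases "s = 0 \<or> s \<ge> 1")
  case True
  then show ?thesis
  proof
    assume "s = 0"
    then show ?thesis by (simp add: w_transform_def)
  next
    assume "s \<ge> 1"
    have "w_transform s \<le> (LINT t:{0..}|lborel. 15 * (1 + t) powr (- 3 / 2))"
      by (rule w_transform_bound(2)[OF assms _ w_transform_integrand_le[OF assms]])
        (use integral_powr_tail(1)[of 0 1] in auto)
    also have "\<dots> = 30"
      using integral_powr_tail(2)[of 0 1] by simp
    finally show ?thesis
      using \<open>s \<ge> 1\<close> by simp
  qed
next
  case False
  then have s: "0 < s" "s < 1"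
    using assms by auto
  have "w_transform s \<le> (LINT t:{0..}|lborel. 60 * (s / (sqrt (1 + t) * (1 + s * (1 + t)))))"
  proof (rule w_transform_bound(2)[OF assms])
    show "set_integrable lborel {0..} (\<lambda>t. 60 * (s / (sqrt (1 + t) * (1 + s * (1 + t)))))"
      using integral_arctan_tail(1)[OF s(1)] by (intro set_integrable_mult_right) auto
  next
    fix t :: real assume t: "t > 0"
    have ts: "t * s > 0"
      using s t by simp
    have e: "1 - exp (- t * s) \<le> 2 * (t * s) / (1 + t * s)"
      using one_minus_exp_neg_le[of "t * s"] ts by simp
    \<comment> \<open>Replacing \<open>1 + t * s\<close> by \<open>1 + s * (1 + t)\<close> costs a
      factor 2 and produces the arctan integrand; the constants multiply to 15 * 2 * 2 = 60.\<close>
    have "t * (1 + s * (1 + t)) \<le> 2 * (1 + t) * (1 + t * s)"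
      using s t mult_left_mono[of s 1 t] ts by (simp add: algebra_simps)
    then have e2: "t / (1 + t * s) \<le> 2 * (1 + t) / (1 + s * (1 + t))"
      using s t by (simp add: divide_simps add_pos_pos)
    have p: "(1 + t) powr (- 3 / 2) = 1 / ((1 + t) * sqrt (1 + t))"
      using t powr_add[of "1 + t" "1" "1 / 2"] by (simp add: powr_minus powr_half_sqrt field_simps)
    have "w t * (1 - exp (- t * s)) \<le> (15 * (1 + t) powr (- 3 / 2)) * (2 * (t * s) / (1 + t * s))"
      using w_le[OF t] e ts w_nonneg by (intro mult_mono) auto
    also have "\<dots> = 30 * s / ((1 + t) * sqrt (1 + t)) * (t / (1 + t * s))"
      unfolding p by simp
    also have "\<dots> \<le> 30 * s / ((1 + t) * sqrt (1 + t)) * (2 * (1 + t) / (1 + s * (1 + t)))"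
      using s t by (intro mult_left_mono e2) auto
    also have "\<dots> = 60 * (s / (sqrt (1 + t) * (1 + s * (1 + t))))"
    proof -
      have "30 * s / (u * r) * (2 * u / v) = 60 * (s / (r * v))" if "u \<noteq> 0" for u r v
        using that by simp
      then show ?thesis
        using t by (metis add_pos_pos less_irrefl zero_less_one)
    qed
    finally show "w t * (1 - exp (- t * s)) \<le> 60 * (s / (sqrt (1 + t) * (1 + s * (1 + t))))" .
  qed
  also have "\<dots> = 60 * (LINT t:{0..}|lborel. s / (sqrt (1 + t) * (1 + s * (1 + t))))"
    by (rule set_integral_mult_right)
  also have "\<dots> \<le> 240 * sqrt s"
    using integral_arctan_tail(2)[OF s(1)] by simp
  finally show ?thesis
    using s by simp
qed

text \<open>On \<open>t \<ge> 1 / m\<close> with \<open>m = min 1 s\<close>, both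
  \<open>t \<ge> 1\<close> and \<open>t * s \<ge> 1\<close> hold. So \<open>w_ge\<close> applies,
  the other factor is at least 1/2, and the remaining tail integral is
  \<open>sqrt m / 8\<close>.\<close>

lemma w_transform_lower:
  assumes "s \<ge> 0"
  shows "min 1 (sqrt s) / 8 \<le> w_transform s"
proof (cases "s = 0")
  case True
  then show ?thesis by (simp add: w_transform_def)
next
  case False
  define m where "m = min 1 s"
  have m: "m > 0" "m \<le> 1" "m \<le> s"
    using False assms by (auto simp: m_def)
  have "(LINT t:{1 / m..}|lborel. 1 / 16 * (0 + t) powr (- 3 / 2)) = 1 / 8 * (1 / m) powr (- 1 / 2)"
    using integral_powr_tail(2)[of "1 / m" 0] m by (simp del: add_0)
  also have "(1 / m) powr (- 1 / 2) = sqrt m"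
    using m by (simp add: powr_minus powr_divide powr_half_sqrt)
  finally have "sqrt m / 8 = (LINT t:{1 / m..}|lborel. 1 / 16 * (0 + t) powr (- 3 / 2))"
    by simp
  also have "\<dots> \<le> (LINT t:{1 / m..}|lborel. w t * (1 - exp (- t * s)))"
  proof (rule set_integral_mono)
    show "set_integrable lborel {1 / m..} (\<lambda>t. 1 / 16 * (0 + t) powr (- 3 / 2))"
      using m integral_powr_tail(1)[of "1 / m" 0] by (intro set_integrable_mult_right) auto
    show "set_integrable lborel {1 / m..} (\<lambda>t. w t * (1 - exp (- t * s)))"
      using m by (intro set_integrable_subset[OF w_transform_integrable[OF assms]])
        (auto intro: less_le_trans[of 0 "1 / m"])
  next
    fix t assume "t \<in> {1 / m..}"
    then have tm: "1 \<le> t * m" "1 / m \<le> t"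
      using m by (auto simp: field_simps)
    have "1 \<le> 1 / m"
      using m by simp
    then have t: "1 \<le> t"
      using tm(2) by linarith
    have "t * m \<le> t * s"
      using t m by (intro mult_left_mono) auto
    then have "1 \<le> t * s"
      using tm by simp
    then have "2 \<le> exp (t * s)"
      using exp_ge_add_one_self[of "t * s"] by linarith
    then have "1 / 2 \<le> 1 - exp (- t * s)"
      by (simp add: exp_minus field_simps)
    then have "t powr (- 3 / 2) / 8 * (1 / 2) \<le> w t * (1 - exp (- t * s))"
      using w_ge[OF t] w_nonneg by (intro mult_mono) auto
    then show "1 / 16 * (0 + t) powr (- 3 / 2) \<le> w t * (1 - exp (- t * s))"
      by simp
  qed
  also have "\<dots> \<le> w_transform s"
    unfolding w_transform_def set_lebesgue_integral_def
  proof (rule integral_mono')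
    show "integrable lborel (\<lambda>t. indicator {0<..} t *\<^sub>R (w t * (1 - exp (- t * s))))"
      using w_transform_integrable[OF assms] by (simp add: set_integrable_def)
  qed (use m assms w_nonneg in \<open>auto simp: indicator_def intro: less_le_trans[of 0 "1 / m"]\<close>)
  finally show ?thesis
    using assms by (simp add: m_def min_def split: if_splits)
qed

subsection \<open>Comparison\<close>

text \<open>The product in \<open>J\<close> is the mean of \<open>exp (- t * S B)\<close> over the
  random set \<open>B\<close>, where \<open>S B\<close> is the sum of squared amplitudes over
  \<open>B\<close>. The weights sum to 1, and the finite mean commutes with the integral.\<close>

lemma J_eq_sum_w_transform:
  "J n p q = (\<Sum>B\<in>Pow {1..n}. wt {1..n} (\<lambda>i. lam (p i) (q i)) B *
      w_transform (\<Sum>i\<in>B. (amp (p i) (q i))\<^sup>2))"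
proof -
  define l where "l = (\<lambda>i. lam (p i) (q i))"
  define a where "a = (\<lambda>i. amp (p i) (q i))"
  define E where "E B t = w t * (1 - exp (- t * (\<Sum>i\<in>B. (a i)\<^sup>2)))" for B t
  have "1 - (\<Prod>i\<in>{1..n}. 1 - l i + l i * exp (- t * (a i)\<^sup>2)) =
      (\<Sum>B\<in>Pow {1..n}. wt {1..n} l B * (1 - exp (- t * (\<Sum>i\<in>B. (a i)\<^sup>2))))" for t
  proof -
    have "(\<Prod>i\<in>{1..n}. 1 - l i + l i * exp (- t * (a i)\<^sup>2)) =
        (\<Sum>B\<in>Pow {1..n}. \<Prod>i\<in>{1..n}. if i \<in> B then l i * exp (- t * (a i)\<^sup>2) else 1 - l i)"
      by (subst sum_Pow_prod_if) (auto simp: add.commute)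
    also have "\<dots> = (\<Sum>B\<in>Pow {1..n}. wt {1..n} l B * exp (- t * (\<Sum>i\<in>B. (a i)\<^sup>2)))"
    proof (intro sum.cong refl)
      fix B assume B: "B \<in> Pow {1..n}"
      then have "finite B"
        using finite_subset by auto
      then have "exp (- t * (\<Sum>i\<in>B. (a i)\<^sup>2)) = (\<Prod>i\<in>B. exp (- t * (a i)\<^sup>2))"
        by (simp add: sum_distrib_left exp_sum flip: sum_negf)
      also have "\<dots> = (\<Prod>i\<in>{1..n}. if i \<in> B then exp (- t * (a i)\<^sup>2) else 1)"
        using B by (intro prod.mono_neutral_cong_left) auto
      finally show "(\<Prod>i\<in>{1..n}. if i \<in> B then l i * exp (- t * (a i)\<^sup>2) else 1 - l i) =
          wt {1..n} l B * exp (- t * (\<Sum>i\<in>B. (a i)\<^sup>2))"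
        by (simp add: wt_def flip: prod.distrib) (intro prod.cong, auto)
    qed
    finally show ?thesis
      using sum_wt[of "{1..n}" l] by (simp add: right_diff_distrib sum_subtractf)
  qed
  then have "w t * (1 - (\<Prod>i\<in>{1..n}. 1 - l i + l i * exp (- t * (a i)\<^sup>2))) =
      (\<Sum>B\<in>Pow {1..n}. wt {1..n} l B * E B t)" for t
    by (simp only: E_def sum_distrib_left mult.left_commute)
  then have "J n p q = (LINT t:{0<..}|lborel. (\<Sum>B\<in>Pow {1..n}. wt {1..n} l B * E B t))"
    by (simp only: J_def l_def a_def)
  also have "\<dots> = (\<Sum>B\<in>Pow {1..n}. LINT t:{0<..}|lborel. wt {1..n} l B * E B t)"
    unfolding set_lebesgue_integral_def scaleR_sum_right
  proof (rule Bochner_Integration.integral_sum)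
    fix B
    have "set_integrable lborel {0<..} (\<lambda>t. wt {1..n} l B * E B t)"
      unfolding E_def by (intro set_integrable_mult_right w_transform_integrable sum_nonneg) auto
    then show "integrable lborel (\<lambda>t. indicator {0<..} t *\<^sub>R (wt {1..n} l B * E B t))"
      by (simp add: set_integrable_def)
  qed
  also have "\<dots> = (\<Sum>B\<in>Pow {1..n}. wt {1..n} l B * w_transform (\<Sum>i\<in>B. (a i)\<^sup>2))"
    by (simp add: E_def w_transform_def)
  finally show ?thesis
    by (simp add: l_def a_def)
qed

theorem mainTheorem2:
  shows "\<exists>c C :: real. c > 0 \<and> C > 0 \<and>
    (\<forall>n :: nat. \<forall>p q :: nat \<Rightarrow> real. n \<ge> 1 \<longrightarrow>
       (\<forall>i\<in>{1..n}. p i \<in> {0..1}) \<longrightarrow> (\<forall>i\<in>{1..n}. q i \<in> {0..1}) \<longrightarrow>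
       c * J n p q \<le> tv_dist (cube n) (Ber n p) (Ber n q) \<and>
       tv_dist (cube n) (Ber n p) (Ber n q) \<le> C * J n p q)"
proof (rule exI[of _ "1 / 1920"], rule exI[of _ 12], intro conjI allI impI)
  fix n :: nat and p q :: "nat \<Rightarrow> real"
  assume p: "\<forall>i\<in>{1..n}. p i \<in> {0..1}" and q: "\<forall>i\<in>{1..n}. q i \<in> {0..1}"
  define I where "I = {1..n}"
  define l where "l = (\<lambda>i. lam (p i) (q i))"
  \<comment> \<open>A signed version of \<open>amp\<close>. Where \<open>l i = 0\<close>, both
    discordance probabilities vanish, and the default 0 gives \<open>h i = 1 / 2\<close>, consistent
    with \<open>l i * h i = p i * (1 - q i)\<close>.\<close>
  define d where "d = (\<lambda>i. if l i > 0 then (p i - q i) / l i else 0)"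
  define h where "h = (\<lambda>i. (1 + d i) / 2)"
  define S where "S B = (\<Sum>i\<in>B. (d i)\<^sup>2)" for B
  define L where "L B = (\<Sum>X\<in>Pow B. \<bar>wt B h X - wt B (\<lambda>i. 1 - h i) X\<bar>)" for B
  \<comment> \<open>The common yardstick to which both \<open>D\<close> and \<open>J n p q\<close>
    are compared.\<close>
  define M where "M = (\<Sum>B\<in>Pow I. wt I l B * min 1 (sqrt (S B)))"
  define D where "D = (\<Sum>X\<in>Pow I. \<Sum>Y\<in>Pow I. \<bar>wt I p X * wt I q Y - wt I q X * wt I p Y\<bar>)"
  have "l i \<in> {0..1} \<and> l i * h i = p i * (1 - q i) \<and> \<bar>d i\<bar> \<le> 1" if "i \<in> I" for i
  proof -
    have pi: "0 \<le> p i" "p i \<le> 1" "0 \<le> q i" "q i \<le> 1"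
      using p q that by (auto simp: I_def)
    \<comment> \<open>The probabilities of the two kinds of disagreement: \<open>l i\<close> is
      their sum and \<open>p i - q i\<close> their difference, whence
      \<open>\<bar>d i\<bar> \<le> 1\<close>.\<close>
    define u v where "u = p i * (1 - q i)" and "v = (1 - p i) * q i"
    have uv: "u \<ge> 0" "v \<ge> 0" "l i = u + v" "p i - q i = u - v"
      unfolding u_def v_def l_def lam_def using pi
      by (simp_all only: mult_nonneg_nonneg diff_ge_0_iff_ge) (simp_all add: algebra_simps)
    have "p i * q i \<ge> 0" "(1 - p i) * (1 - q i) \<ge> 0"
      using pi by auto
    then have "l i \<le> 1"
      by (simp add: l_def lam_def algebra_simps)
    have "l i * d i = u - v"
      using uv by (auto simp: d_def)
    then have "l i * h i = u"
      using uv by (simp add: h_def field_simps)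
    moreover have "\<bar>d i\<bar> \<le> 1"
      using uv by (simp add: d_def abs_le_iff pos_le_divide_eq)
    ultimately show ?thesis
      using uv \<open>l i \<le> 1\<close> by (simp add: u_def)
  qed
  then have l: "l i \<in> {0..1}" and lh: "l i * h i = p i * (1 - q i)" and d1: "\<bar>d i\<bar> \<le> 1"
    if "i \<in> I" for i
    using that by blast+
  have S_amp: "S B = (\<Sum>i\<in>B. (amp (p i) (q i))\<^sup>2)" for B
    unfolding S_def by (intro sum.cong) (auto simp: d_def amp_def l_def power_divide)
  have J: "J n p q = (\<Sum>B\<in>Pow I. wt I l B * w_transform (S B))"
    by (simp add: J_eq_sum_w_transform S_amp I_def l_def)
  have D: "D = (\<Sum>B\<in>Pow I. wt I l B * L B)"
    using sum_symmetrized_eq_mixture[of I p q l h 1 1] p q lh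
    by (simp add: D_def L_def I_def l_def)
  have wt0: "wt I l B \<ge> 0" for B
    using l by (rule wt_nonneg)
  have L_bounds: "min 1 (sqrt (S B)) / 2 \<le> L B" "L B \<le> 3 * min 1 (sqrt (S B))" if "B \<in> Pow I" for B
  proof -
    have "finite B" "B \<subseteq> I"
      using that finite_subset[of B I] by (auto simp: I_def)
    then show "min 1 (sqrt (S B)) / 2 \<le> L B" "L B \<le> 3 * min 1 (sqrt (S B))"
      unfolding L_def using d1 by (intro tilt_l1_bounds[where d = d]; auto simp: h_def S_def)+
  qed
  have S0: "S B \<ge> 0" for B
    by (simp add: S_def sum_nonneg)
  have "M / 2 \<le> D" "D \<le> 3 * M"
    unfolding D M_def sum_distrib_left sum_divide_distrib
    by (intro sum_mono; use mult_left_mono[OF L_bounds(1) wt0] mult_left_mono[OF L_bounds(2) wt0]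
          in \<open>simp add: mult.left_commute\<close>)+
  moreover have "M / 8 \<le> J n p q" "J n p q \<le> 240 * M"
    unfolding J M_def sum_distrib_left sum_divide_distrib
    by (intro sum_mono; use mult_left_mono[OF w_transform_lower[OF S0] wt0]
          mult_left_mono[OF w_transform_upper[OF S0] wt0] in \<open>simp add: mult.left_commute\<close>)+
  moreover have "2 * tv_dist (cube n) (Ber n p) (Ber n q) \<le> D"
    "D \<le> 4 * tv_dist (cube n) (Ber n p) (Ber n q)"
  proof -
    have fin: "finite I"
      by (simp add: I_def)
    have nonneg: "wt I p X \<ge> 0" "wt I q X \<ge> 0" for X
      using p q by (auto intro!: wt_nonneg simp: I_def)
    have tv: "2 * tv_dist (cube n) (Ber n p) (Ber n q) = (\<Sum>X\<in>Pow I. \<bar>wt I p X - wt I q X\<bar>)"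
      using p q by (subst tv_dist_Ber) (auto simp: I_def)
    show "2 * tv_dist (cube n) (Ber n p) (Ber n q) \<le> D"
      unfolding tv D_def using nonneg sum_wt[OF fin] by (intro symmetrize_bounds(1)) auto
    have "D \<le> 2 * (2 * tv_dist (cube n) (Ber n p) (Ber n q))"
      unfolding tv D_def using nonneg sum_wt[OF fin] by (intro symmetrize_bounds(2)) auto
    then show "D \<le> 4 * tv_dist (cube n) (Ber n p) (Ber n q)"
      by simp
  qed
  \<comment> \<open>The distance is at least D/4, hence M/8, hence J/1920; it is at most D/2, hence
    3M/2, hence 12J.\<close>
  ultimately show "1 / 1920 * J n p q \<le> tv_dist (cube n) (Ber n p) (Ber n q)"
    "tv_dist (cube n) (Ber n p) (Ber n q) \<le> 12 * J n p q"
    by linarith+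
qed auto

end
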